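(* Let $\Phi(h,\boldsymbol{y})$ be a pseudo-symplectic integrator with pseudo-symplectic order $s$ ($s\ge 0$) and time step $h$ ($h<1$) for the Hamiltonian system $$\frac{d\boldsymbol{y}}{dt}=J^{-1}\nabla H(\boldsymbol{y}),\qquad \boldsymbol{y}(0)=\boldsymbol{y}_0\in\mathbb{R}^{2d},\qquad J=\begin{pmatrix}0 & I_d\\ -I_d & 0\end{pmatrix}.$$ Then for any $K\in\mathbb{Z}_{+}$, the $K$ times composition of $\Phi$, $$\Phi^K=\underbrace{\Phi\circ\Phi\circ\cdots\circ\Phi}_{K\text{ times}},$$ is still pseudo-symplectic with pseudo-symplectic order $s$.
   Context: Here $H:\mathbb{R}^{2d}\to\mathbb{R}$ is a smooth scalar function (the Hamiltonian function), $I_d$ is the $d$-dimensional identity matrix, and $\mathbb{Z}_+$ is the set of positive integers. A one-step numerical method (integrator) with time step $h$ for the system is a map $\Phi(h,\cdot):\boldsymbol{y}_n\mapsto\boldsymbol{y}_{n+1}$ ($n=0,1,\dots$) discretizing the system. The composition $\Phi^K$ is taken in the variable $\boldsymbol{y}$, with the same step $h$ in each factor. Definition. A one-step numerical method $\Phi(h,\boldsymbol{y}_n)$ with step size $h$ applied to the Hamiltonian system is called pseudo-symplectic of pseudo-symplectic order $s$ if it satisfies $$\left(\frac{\partial\Phi(h,\boldsymbol{y}_n)}{\partial \boldsymbol{y}_n}\right)^{T}J\,\frac{\partial\Phi(h,\boldsymbol{y}_n)}{\partial \boldsymbol{y}_n}=J+\mathcal{O}(h^{s+1}),\qquad \forall\,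 n=0,1,\dots,$$ where $\partial\Phi/\partial\boldsymbol{y}_n$ is the Jacobian matrix of $\Phi(h,\cdot)$ at $\boldsymbol{y}_n$. The conclusion that $\Phi^K$ is pseudo-symplectic of order $s$ means that the same relation holds with $\Phi$ replaced by $\Phi^K$.
   Formalization: The integrator is additionally assumed to satisfy Φ(0,y)=y, to be consistent with the system, and to have Φ and its Jacobian in y jointly continuous at h=0; without control of the Jacobian as h→0 the claim fails for d≥2. *)

theory Defs
  imports "HOL-Analysis.Analysis" "HOL-Library.Landau_Symbols"
begin

text \<open>
  The phase space \<open>\<real>\<^sup>2\<^sup>d\<close> is \<open>real ^ ('d + 'd)\<close> with \<open>d = CARD('d)\<close>: indices \<open>Inl i\<close> are the first
  \<open>d\<close> coordinates, indices \<open>Inr i\<close> the last \<open>d\<close>.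
\<close>

definition J :: "real ^ ('d::finite + 'd) ^ ('d + 'd)" where
  "J = (\<chi> a b. case (a, b) of
          (Inl i, Inr j) \<Rightarrow> if i = j then 1 else 0
        | (Inr i, Inl j) \<Rightarrow> if i = j then - 1 else 0
        | _ \<Rightarrow> 0)"

fun Ck :: "nat \<Rightarrow> ('a::euclidean_space \<Rightarrow> real) \<Rightarrow> bool" where
  "Ck 0 f \<longleftrightarrow> continuous_on UNIV f"
| "Ck (Suc k) f \<longleftrightarrow> (\<forall>x. f differentiable (at x)) \<and>
     (\<forall>b\<in>Basis. Ck k (\<lambda>x. frechet_derivative f (at x) b))"

definition smooth :: "('a::euclidean_space \<Rightarrow> real) \<Rightarrow> bool" where
  "smooth f \<longleftrightarrow> (\<forall>k. Ck k f)"

definition grad :: "('a::real_inner \<Rightarrow> real) \<Rightarrow> 'a \<Rightarrow> 'a" where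
  "grad H y = (THE D. GDERIV H y :> D)"

definition hamiltonian_field ::
    "(real ^ ('d::finite + 'd) \<Rightarrow> real) \<Rightarrow> real ^ ('d + 'd) \<Rightarrow> real ^ ('d + 'd)" where
  "hamiltonian_field H y = matrix_inv J *v grad H y"

text \<open>
  \<open>\<Phi>\<close> is a one-step method for \<open>y' = J\<^sup>-\<^sup>1 \<nabla>H(y)\<close>: it is consistent with the system, and \<open>\<Phi>(h, y)\<close>
  and its Jacobian in \<open>y\<close> depend continuously on \<open>(h, y)\<close> as \<open>h\<close> tends to \<open>0\<close>. Nothing is required away
  from \<open>h = 0\<close>, so that implicit methods, which are well behaved only for small \<open>h\<close> (depending on \<open>y\<close>),
  are included. The continuity of the Jacobian cannot be dropped: the pseudo-symplecticity relation
  alone does not bound the Jacobian, and an unbounded factor amplifies the \<open>O(h\<^sup>s\<^sup>+\<^sup>1)\<close> defects of the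
  other factors in a composition.
\<close>

definition one_step_method ::
    "(real ^ ('d::finite + 'd) \<Rightarrow> real) \<Rightarrow>
     (real \<Rightarrow> real ^ ('d + 'd) \<Rightarrow> real ^ ('d + 'd)) \<Rightarrow> bool" where
  "one_step_method H \<Phi> \<longleftrightarrow> (\<forall>y.
     \<Phi> 0 y = y \<and>
     ((\<lambda>h. \<Phi> h y) has_vector_derivative hamiltonian_field H y) (at 0 within {0..<1}) \<and>
     continuous (at (0, y) within {0..<1} \<times> UNIV) (\<lambda>(h, z). \<Phi> h z) \<and>
     (\<forall>\<^sub>F (h, z) in at (0, y) within {0..<1} \<times> UNIV. \<Phi> h differentiable (at z)) \<and>
     continuous (at (0, y) within {0..<1} \<times> UNIV) (\<lambda>(h, z). jacobian (\<Phi> h) (at z)))"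

text \<open>
  The points \<open>y\<^sub>n = \<Phi>(h, \<cdot>)\<^sup>n(y\<^sub>0)\<close> depend on \<open>h\<close>. The \<open>O\<close>-relation is taken for \<open>h \<rightarrow> 0\<^sup>+\<close>
  separately for each \<open>n\<close>, so its constant may depend on \<open>n\<close>. Differentiability is stated explicitly
  because \<open>jacobian\<close> is a total function.
\<close>

definition pseudo_symplectic ::
    "(real \<Rightarrow> real ^ ('d::finite + 'd) \<Rightarrow> real ^ ('d + 'd)) \<Rightarrow> nat \<Rightarrow> real ^ ('d + 'd) \<Rightarrow> bool" where
  "pseudo_symplectic \<Phi> s y0 \<longleftrightarrow> (\<forall>n.
     let y = (\<lambda>h. (\<Phi> h ^^ n) y0); D = (\<lambda>h. jacobian (\<Phi> h) (at (y h))) in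
       (\<forall>h\<in>{0<..<1}. \<Phi> h differentiable (at (y h))) \<and>
       (\<lambda>h. norm (transpose (D h) ** J ** D h - J)) \<in> O[at_right 0](\<lambda>h. h ^ (s + 1)))"

end

theory Submission
  imports Defs
begin

text \<open>
  As \<open>h \<rightarrow> 0\<^sup>+\<close> every iterate \<open>y\<^sub>n(h)\<close> tends to \<open>y\<^sub>0\<close>, so the Jacobians along the orbit converge and
  in particular stay bounded. By the chain rule the Jacobian of \<open>\<Phi>\<^sup>k\<^sup>+\<^sup>1\<close> at \<open>y\<^sub>m\<close> is a product \<open>A B\<close>, with
  \<open>A\<close> that of \<open>\<Phi>\<close> at \<open>y\<^sub>m\<^sub>+\<^sub>k\<close> and \<open>B\<close> that of \<open>\<Phi>\<^sup>k\<close> at \<open>y\<^sub>m\<close>, and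
  \<open>(A B)\<^sup>T J (A B) - J = B\<^sup>T (A\<^sup>T J A - J) B + (B\<^sup>T J B - J)\<close>. Boundedness of \<open>B\<close> thus propagates the
  order of the defect by induction on \<open>k\<close>.
\<close>

lemma bounded_bilinear_matrix_matrix_mult:
  "bounded_bilinear ((**) :: real^'m^'n \<Rightarrow> real^'p^'m \<Rightarrow> real^'p^'n)"
  unfolding bilinear_conv_bounded_bilinear[symmetric] bilinear_def
  by (auto intro!: linearI
      simp: matrix_matrix_mult_def vec_eq_iff sum.distrib sum_distrib_left algebra_simps)

lemma jacobian_compose:
  fixes f :: "real^'m \<Rightarrow> real^'n" and g :: "real^'p \<Rightarrow> real^'m"
  assumes "g differentiable (at x)" "f differentiable (at (g x))"
  shows "jacobian (f \<circ> g) (at x) = jacobian f (at (g x)) ** jacobian g (at x)"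
proof -
  let ?f = "frechet_derivative f (at (g x))" and ?g = "frechet_derivative g (at x)"
  have "frechet_derivative (f \<circ> g) (at x) = ?f \<circ> ?g"
    using assms by (rule frechet_derivative_compose)
  then show ?thesis
    using assms by (simp add: jacobian_def matrix_compose linear_frechet_derivative)
qed

lemma symplectic_defect_mult:
  fixes A B M :: "real^'n^'n"
  shows "transpose (A ** B) ** M ** (A ** B) - M =
    transpose B ** (transpose A ** M ** A - M) ** B + (transpose B ** M ** B - M)"
  by (simp add: matrix_transpose_mul matrix_mul_assoc
      bounded_bilinear.diff_left[OF bounded_bilinear_matrix_matrix_mult]
      bounded_bilinear.diff_right[OF bounded_bilinear_matrix_matrix_mult])

text \<open>The two factors enter asymmetrically: \<open>A\<close> occurs only inside its own defect
  and needs no bound, while \<open>B\<close> multiplies that defect from both sides. The limit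
  \<open>L\<close> serves to make \<open>B\<close> and its transpose O(1) along
  \<open>F\<close>.\<close>

lemma symplectic_defect_mult_bigo:
  fixes A B :: "'b \<Rightarrow> real^'n^'n"
  assumes A: "(\<lambda>h. norm (transpose (A h) ** M ** A h - M)) \<in> O[F](g)"
    and B: "(\<lambda>h. norm (transpose (B h) ** M ** B h - M)) \<in> O[F](g)"
    and lim: "(B \<longlongrightarrow> L) F"
  shows "(\<lambda>h. norm (transpose (A h ** B h) ** M ** (A h ** B h) - M)) \<in> O[F](g)"
proof -
  obtain c where c: "\<And>(X :: real^'n^'n) (Y :: real^'n^'n). norm (X ** Y) \<le> norm X * norm Y * c" "c > 0"
    using bounded_bilinear.pos_bounded[OF bounded_bilinear_matrix_matrix_mult] by blast
  let ?E = "\<lambda>h. transpose (A h) ** M ** A h - M"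
  have B1: "(\<lambda>h. norm (B h)) \<in> O[F](\<lambda>_. 1)"
    using tendsto_norm[OF lim] by (intro bigoI_tendsto[where c = "norm L"]) auto
  have "((\<lambda>h. transpose (B h)) \<longlongrightarrow> transpose L) F"
    unfolding transpose_def using lim by (intro tendsto_intros)
  then have Bt: "(\<lambda>h. norm (transpose (B h))) \<in> O[F](\<lambda>_. 1)"
    by (intro bigoI_tendsto[where c = "norm (transpose L)"]) (auto intro: tendsto_norm)
  have "(\<lambda>h. norm (transpose (B h) ** ?E h ** B h))
      \<in> O[F](\<lambda>h. norm (transpose (B h)) * norm (?E h) * norm (B h))"
  \<comment> \<open>Each of the two matrix products costs one factor \<open>c\<close>.\<close>
  proof (rule bigoI[where c = "c * c"], rule always_eventually, rule allI)
    fix h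
    have "norm (transpose (B h) ** ?E h ** B h) \<le> norm (transpose (B h) ** ?E h) * norm (B h) * c"
      by (rule c)
    also have "\<dots> \<le> (norm (transpose (B h)) * norm (?E h) * c) * norm (B h) * c"
      using c by (intro mult_right_mono) auto
    finally show "norm (norm (transpose (B h) ** ?E h ** B h))
        \<le> c * c * norm (norm (transpose (B h)) * norm (?E h) * norm (B h))"
      by (simp add: mult_ac)
  qed
  also have "(\<lambda>h. norm (transpose (B h)) * norm (?E h) * norm (B h)) \<in> O[F](\<lambda>h. 1 * g h * 1)"
    by (intro landau_o.big.mult Bt A B1)
  finally have "(\<lambda>h. norm (transpose (B h) ** ?E h ** B h)) \<in> O[F](g)"
    by simp
  then have "(\<lambda>h. norm (transpose (B h) ** ?E h ** B h) + norm (transpose (B h) ** M ** B h - M))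
      \<in> O[F](g)"
    using B by (rule sum_in_bigo)
  moreover have "(\<lambda>h. norm (transpose (A h ** B h) ** M ** (A h ** B h) - M)) \<in>
      O[F](\<lambda>h. norm (transpose (B h) ** ?E h ** B h) + norm (transpose (B h) ** M ** B h - M))"
    by (intro bigoI[where c = 1] always_eventually allI)
      (simp add: symplectic_defect_mult norm_triangle_ineq)
  ultimately show ?thesis
    using landau_o.big.trans by blast
qed

text \<open>Turns joint limits in step size and point into limits along a curve whose point moves
  with \<open>h\<close>, as orbit points do.\<close>

lemma one_step_method_graph_tendsto:
  assumes "(y \<longlongrightarrow> y0) (at_right (0::real))"
  shows "filterlim (\<lambda>h. (h, y h)) (at (0, y0) within {0..<1} \<times> UNIV) (at_right 0)"
  unfolding filterlim_at
proof
  show "((\<lambda>h. (h, y h)) \<longlongrightarrow> (0, y0)) (at_right 0)"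
    using assms by (intro tendsto_intros)
  \<comment> \<open>Since \<open>h > 0\<close>, the curve never meets the excluded base point, even
    where \<open>y h = y0\<close>.\<close>
  show "\<forall>\<^sub>F h in at_right 0. (h, y h) \<in> {0..<1} \<times> UNIV \<and> (h, y h) \<noteq> (0, y0)"
    using eventually_at_right_real[of "0::real" 1] by (auto elim: eventually_mono)
qed

text \<open>The joint limit is \<open>\<Phi> 0 y0 = y0\<close>, so a step preserves convergence to
  \<open>y0\<close> and the argument can be iterated.\<close>

lemma one_step_method_tendsto:
  assumes "one_step_method H \<Phi>" "(y \<longlongrightarrow> y0) (at_right 0)"
  shows "((\<lambda>h. \<Phi> h (y h)) \<longlongrightarrow> y0) (at_right 0)"
proof -
  have "((\<lambda>(h, z). \<Phi> h z) \<longlongrightarrow> y0) (at (0, y0) within {0..<1} \<times> UNIV)"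
    using assms(1)[unfolded one_step_method_def continuous_within, rule_format, of y0] by auto
  from filterlim_compose[OF this one_step_method_graph_tendsto[OF assms(2)]] show ?thesis
    by simp
qed

lemma one_step_method_jacobian_tendsto:
  assumes "one_step_method H \<Phi>" "(y \<longlongrightarrow> y0) (at_right 0)"
  shows "((\<lambda>h. jacobian (\<Phi> h) (at (y h))) \<longlongrightarrow> jacobian (\<Phi> 0) (at y0)) (at_right 0)"
proof -
  have "((\<lambda>(h, z). jacobian (\<Phi> h) (at z)) \<longlongrightarrow> jacobian (\<Phi> 0) (at y0))
      (at (0, y0) within {0..<1} \<times> UNIV)"
    using assms(1)[unfolded one_step_method_def continuous_within, rule_format, of y0] by simp
  from filterlim_compose[OF this one_step_method_graph_tendsto[OF assms(2)]] show ?thesis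
    by simp
qed

lemma one_step_method_funpow_tendsto:
  assumes "one_step_method H \<Phi>"
  shows "((\<lambda>h. (\<Phi> h ^^ n) y0) \<longlongrightarrow> y0) (at_right 0)"
  by (induction n) (use one_step_method_tendsto[OF assms] in auto)

text \<open>The existence of a limit is carried through the induction because the next step needs
  the Jacobian of the inner factor \<open>\<Phi> h ^^ k\<close> to stay bounded. The starting index
  \<open>m\<close> is free so that blocks of steps can begin anywhere on the orbit.\<close>

lemma pseudo_symplectic_funpow:
  fixes \<Phi> :: "real \<Rightarrow> real ^ ('d::finite + 'd) \<Rightarrow> real ^ ('d + 'd)"
  assumes "one_step_method H \<Phi>" "pseudo_symplectic \<Phi> s y0"
  defines "y \<equiv> \<lambda>n h. (\<Phi> h ^^ n) y0"
  shows "(\<forall>h\<in>{0<..<1}. (\<Phi> h ^^ k) differentiable (at (y m h))) \<and>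
    (\<exists>L. ((\<lambda>h. jacobian (\<Phi> h ^^ k) (at (y m h))) \<longlongrightarrow> L) (at_right 0)) \<and>
    (\<lambda>h. norm (transpose (jacobian (\<Phi> h ^^ k) (at (y m h))) ** J **
      jacobian (\<Phi> h ^^ k) (at (y m h)) - J)) \<in> O[at_right 0](\<lambda>h. h ^ (s + 1))"
proof (induction k)
  case 0
  \<comment> \<open>The empty composition has a constant Jacobian and zero defect.\<close>
  have "jacobian id (at x) = mat 1" for x :: "real ^ ('d + 'd)"
    by (simp add: jacobian_def frechet_derivative_id matrix_id_mat_1 id_def[symmetric])
  then show ?case
    by (auto simp: id_def differentiable_ident)
next
  case (Suc k)
  let ?A = "\<lambda>h. jacobian (\<Phi> h) (at (y (m + k) h))"
    and ?B = "\<lambda>h. jacobian (\<Phi> h ^^ k) (at (y m h))"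
  obtain L where L: "(?B \<longlongrightarrow> L) (at_right 0)"
    using Suc by blast
  have y: "(\<Phi> h ^^ k) (y m h) = y (m + k) h" for h
    by (simp add: y_def funpow_add add.commute[of m])
  have A: "\<forall>h\<in>{0<..<1}. \<Phi> h differentiable (at (y (m + k) h))"
    "(\<lambda>h. norm (transpose (?A h) ** J ** ?A h - J)) \<in> O[at_right 0](\<lambda>h. h ^ (s + 1))"
    using assms(2) unfolding pseudo_symplectic_def Let_def y_def by blast+
  have jac: "jacobian (\<Phi> h ^^ Suc k) (at (y m h)) = ?A h ** ?B h" if "h \<in> {0<..<1}" for h
    using jacobian_compose[of "\<Phi> h ^^ k" "y m h" "\<Phi> h"] Suc A(1) that by (simp add: y)
  \<comment> \<open>The chain rule is available only for \<open>0 < h < 1\<close>, which suffices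
    for limits and O-relations at \<open>0\<close> from the right.\<close>
  have ev: "\<forall>\<^sub>F h in at_right 0. ?A h ** ?B h = jacobian (\<Phi> h ^^ Suc k) (at (y m h))"
    using eventually_at_right_real[of "0::real" 1] by (auto elim!: eventually_mono simp: jac simp del: funpow.simps)
  have "((\<lambda>h. ?A h ** ?B h) \<longlongrightarrow> jacobian (\<Phi> 0) (at y0) ** L) (at_right 0)"
    unfolding y_def using L[unfolded y_def]
    by (intro bounded_bilinear.tendsto[OF bounded_bilinear_matrix_matrix_mult]
        one_step_method_jacobian_tendsto[OF assms(1)]
        one_step_method_funpow_tendsto[OF assms(1)])
  then have lim: "((\<lambda>h. jacobian (\<Phi> h ^^ Suc k) (at (y m h))) \<longlongrightarrow>
      jacobian (\<Phi> 0) (at y0) ** L) (at_right 0)"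
    using ev by (rule Lim_transform_eventually)
  have "(\<lambda>h. norm (transpose (?A h ** ?B h) ** J ** (?A h ** ?B h) - J))
      \<in> O[at_right 0](\<lambda>h. h ^ (s + 1))"
    using A(2) Suc L by (intro symplectic_defect_mult_bigo) auto
  also have "?this \<longleftrightarrow> (\<lambda>h. norm (transpose (jacobian (\<Phi> h ^^ Suc k) (at (y m h))) ** J **
      jacobian (\<Phi> h ^^ Suc k) (at (y m h)) - J)) \<in> O[at_right 0](\<lambda>h. h ^ (s + 1))"
    by (rule landau_o.big.in_cong) (use ev in \<open>auto elim: eventually_mono\<close>)
  finally have defect: "\<dots>" .
  have "(\<Phi> h ^^ Suc k) differentiable (at (y m h))" if "h \<in> {0<..<1}" for h
    using differentiable_chain_at[of "\<Phi> h ^^ k" "y m h" "\<Phi> h"] Suc A(1) that by (simp add: y)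
  with lim defect show ?case
    by blast
qed

theorem theorem3p2:
  fixes H :: "real ^ ('d::finite + 'd) \<Rightarrow> real"
    and \<Phi> :: "real \<Rightarrow> real ^ ('d + 'd) \<Rightarrow> real ^ ('d + 'd)"
    and y0 :: "real ^ ('d + 'd)"
    and s K :: nat
  assumes "smooth H"
    and "one_step_method H \<Phi>"
    and "pseudo_symplectic \<Phi> s y0"
    and "K > 0"
  shows "pseudo_symplectic (\<lambda>h. \<Phi> h ^^ K) s y0"
  \<comment> \<open>The \<open>n\<close>-th orbit point of \<open>\<Phi> h ^^ K\<close> is the orbit
    point of \<open>\<Phi> h\<close> with index \<open>K * n\<close>, so the lemma applies with
    \<open>k = K\<close> and \<open>m = K * n\<close>.\<close>
  using pseudo_symplectic_funpow[OF assms(2,3)]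
  by (simp add: pseudo_symplectic_def Let_def funpow_mult)

end
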